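(* Let $\ell\ge1$ and let $r_{e,\ell}(\mathcal{C}_n)$ be the number of regions of level $\ell$ of the Catalan arrangement $\mathcal{C}_n$ contained in $\{x_1>\dots>x_n\}$. Then \[\sum_{n\ge1} r_{e,\ell}(\mathcal{C}_n)\,t^n=(tC(t))^{\ell},\qquad\text{equivalently}\qquad r_{e,\ell}(\mathcal{C}_n)=\frac{\ell}{2n-\ell}\binom{2n-\ell}{n}\ \ (1\le\ell\le n),\] where $C(t)=\sum_{n\ge0}\frac{1}{n+1}\binom{2n}{n}t^n$ is the generating function of the Catalan numbers.
   Context: The Catalan arrangement $\mathcal{C}_n$ is the arrangement in $\mathbb{R}^n$ of hyperplanes $x_i-x_j=0,1$ for $i\ne j$ (i.e. $x_i-x_j\in\{-1,0,1\}$); for $n=1$ it is empty with unique region $\mathbb{R}$. Regions are connected components of the complement. The level of $X\subseteq\mathbb{R}^n$ is the smallest integer $\ell\ge0$ such that there are a linear subspace $W$ of dimension $\ell$ and $r>0$ with $X\subseteq\{\bm x:\min_{\bm y\in W}\|\bm x-\bm y\|\le r\}$. *)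

theory Defs
  imports "HOL-Analysis.Analysis"
begin

text \<open>Points of R^n are vectors of type real^'n, n = CARD('n); coordinates are
  indexed by the linearly ordered finite type 'n (x_1,...,x_n in the order of 'n).\<close>

definition catalan_complement :: "(real ^ 'n) set" where
  "catalan_complement = {x. \<forall>i j. i \<noteq> j \<longrightarrow> x $ i - x $ j \<notin> {-1, 0, 1}}"

definition catalan_regions :: "(real ^ 'n) set set" where
  "catalan_regions = {connected_component_set catalan_complement x | x. x \<in> catalan_complement}"

definition level :: "'a::euclidean_space set \<Rightarrow> nat" where
  "level X = (LEAST l. \<exists>W r. subspace W \<and> dim W = l \<and> r > 0 \<and>
                         X \<subseteq> {x. infdist x W \<le> r})"

definition dominant_cone :: "(real ^ ('n::{finite,linorder})) set" where
  "dominant_cone = {x. \<forall>i j. i < j \<longrightarrow> x $ i > x $ j}"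

end

theory Submission
  imports Defs
begin

text \<open>On the dominant cone, write the coordinates in increasing order and record, for the one at
  position \<open>m\<close>, how many coordinates lie more than 1 below it. This number is weakly increasing and
  at most \<open>m\<close>, every such sequence occurs, and two points lie in the same region iff their
  sequences agree. Equality at position \<open>m\<close> means that the gap just below it exceeds 1;
  exactly these gaps are unbounded on the region, so the level is the number of \<open>m\<close> with equality.
  Sequences of length \<open>n\<close> with \<open>l\<close> equalities and entries at most \<open>k\<close> satisfy Pascal's recursion, with
  solution \<open>binomial (n+k-l) (n-1) - binomial (n+k-l) n\<close>.\<close>

section \<open>Counting subdiagonal sequences\<close>

definition subdiagonal :: "nat list \<Rightarrow> bool" where
  "subdiagonal gs \<longleftrightarrow> sorted gs \<and> (\<forall>i<length gs. gs ! i \<le> i)"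

definition contacts :: "nat list \<Rightarrow> nat" where
  "contacts gs = card {i. i < length gs \<and> gs ! i = i}"

text \<open>The cap \<open>k\<close> is the second parameter of the recursion: deleting the last
  entry \<open>g\<close> leaves a list capped by \<open>g\<close>.\<close>

definition subdiagonal_lists :: "nat \<Rightarrow> nat \<Rightarrow> nat \<Rightarrow> nat list set" where
  "subdiagonal_lists n k l =
     {gs. length gs = n \<and> subdiagonal gs \<and> (\<forall>g\<in>set gs. g \<le> k) \<and> contacts gs = l}"

lemma contacts_snoc:
  "contacts (gs @ [g]) = contacts gs + (if g = length gs then 1 else 0)"
proof -
  have "{i. i < length (gs @ [g]) \<and> (gs @ [g]) ! i = i}
      = {i. i < length gs \<and> gs ! i = i} \<union> (if g = length gs then {length gs} else {})"
    by (auto simp: nth_append less_Suc_eq)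
  then show ?thesis
    by (auto simp: contacts_def)
qed

lemma subdiagonal_snoc:
  "subdiagonal (gs @ [g]) \<longleftrightarrow> subdiagonal gs \<and> (\<forall>h\<in>set gs. h \<le> g) \<and> g \<le> length gs"
  by (auto simp: subdiagonal_def sorted_append nth_append less_Suc_eq)

lemma finite_subdiagonal_lists: "finite (subdiagonal_lists n k l)"
proof (rule finite_subset)
  show "subdiagonal_lists n k l \<subseteq> {xs. set xs \<subseteq> {..k} \<and> length xs = n}"
    by (auto simp: subdiagonal_lists_def)
  show "finite {xs. set xs \<subseteq> {..k} \<and> length xs = n}"
    by (rule finite_lists_length_eq) simp
qed

lemma snoc_in_subdiagonal_lists:
  "gs @ [g] \<in> subdiagonal_lists (Suc n) k l \<longleftrightarrow>
     g \<le> k \<and> g \<le> n \<and> (if g = n then l \<noteq> 0 \<and> gs \<in> subdiagonal_lists n g (l - 1)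
                        else gs \<in> subdiagonal_lists n g l)"
  by (auto simp: subdiagonal_lists_def subdiagonal_snoc contacts_snoc)

text \<open>Split by the last entry \<open>g\<close>. It stands at position \<open>n\<close>, so it
  is a contact exactly when \<open>g = n\<close>.\<close>

lemma subdiagonal_lists_Suc_eq:
  "subdiagonal_lists (Suc n) k l =
     (\<Union>g\<in>{..min k n}. (\<lambda>gs. gs @ [g]) `
        (if g = n then (if l = 0 then {} else subdiagonal_lists n g (l - 1))
         else subdiagonal_lists n g l))" (is "?L = ?R")
proof (rule set_eqI)
  fix hs :: "nat list"
  show "hs \<in> ?L \<longleftrightarrow> hs \<in> ?R"
  proof (cases hs rule: rev_cases)
    case Nil
    then show ?thesis by (auto simp: subdiagonal_lists_def)
  next
    case (snoc gs g)
    show ?thesis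
      unfolding snoc snoc_in_subdiagonal_lists by auto
  qed
qed

lemma card_subdiagonal_lists_Suc:
  "card (subdiagonal_lists (Suc n) k l) =
     (\<Sum>g\<le>min k n. if g = n then (if l = 0 then 0 else card (subdiagonal_lists n g (l - 1)))
                   else card (subdiagonal_lists n g l))"
  unfolding subdiagonal_lists_Suc_eq
  by (subst card_UN_disjoint)
     (auto simp: finite_subdiagonal_lists card_image inj_on_def intro!: sum.cong)

text \<open>The entry at position \<open>i\<close> is at most \<open>i\<close>, hence at most
  \<open>n - 1\<close>, so all caps from \<open>n - 1\<close> upwards give the same set.\<close>

lemma subdiagonal_lists_bound_cap:
  assumes "n \<le> Suc k"
  shows "subdiagonal_lists n k l = subdiagonal_lists n (n - 1) l"
proof -
  have "g \<le> n - 1 \<and> g \<le> k" if asm: "length gs = n" "subdiagonal gs" "g \<in> set gs" for gs g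
  proof -
    obtain i where i: "i < length gs" "g = gs ! i"
      using asm(3) by (auto simp: in_set_conv_nth)
    then have "g \<le> i"
      using asm(2) by (simp add: subdiagonal_def)
    then show ?thesis
      using i(1) asm(1) assms by linarith
  qed
  then show ?thesis
    unfolding subdiagonal_lists_def by blast
qed

text \<open>Only the zero list has cap 0, and its single contact is at position 0.\<close>

lemma card_subdiagonal_lists_0:
  "card (subdiagonal_lists (Suc n) 0 l) = (if l = 1 then 1 else 0)"
proof (induction n)
  case 0
  have "subdiagonal_lists 0 0 m = (if m = 0 then {[]} else {})" for m
    by (auto simp: subdiagonal_lists_def subdiagonal_def contacts_def)
  then show ?case
    by (auto simp: card_subdiagonal_lists_Suc)
next
  case (Suc n)
  then show ?case
    by (simp add: card_subdiagonal_lists_Suc[of "Suc n"])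
qed

text \<open>The first entry is forced to be 0 and is therefore a contact.\<close>

lemma no_contacts_empty:
  "subdiagonal_lists (Suc n) k 0 = {}"
proof -
  have "contacts gs \<noteq> 0" if "subdiagonal gs" "length gs = Suc n" for gs
  proof -
    have "0 \<in> {i. i < length gs \<and> gs ! i = i}"
      using that by (auto simp: subdiagonal_def)
    then show ?thesis
      unfolding contacts_def by (subst card_0_eq) auto
  qed
  then show ?thesis
    by (auto simp: subdiagonal_lists_def)
qed

text \<open>Both recursions for the count (below the diagonal and on it) are Pascal's rule for the
  same difference of binomial coefficients; the guard avoids truncated subtraction.\<close>

definition ballot :: "nat \<Rightarrow> nat \<Rightarrow> nat \<Rightarrow> int" where
  "ballot n k l = (if l \<le> Suc n + k
     then int ((Suc n + k - l) choose n) - int ((Suc n + k - l) choose Suc n) else 0)"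

lemma ballot_Pascal:
  "ballot (Suc n) (Suc k) l = ballot (Suc n) k l + ballot n (Suc k) l"
proof (cases "l \<le> n + k + 2")
  case True
  then have "Suc (Suc n) + Suc k - l = Suc (n + k + 2 - l)" by simp
  with True show ?thesis
    by (simp add: ballot_def)
next
  case False
  then show ?thesis
    \<comment> \<open>At \<open>l = n + k + 3\<close> only the guard on the left holds; both
      binomials there have upper index 0 and positive lower index, so they vanish.\<close>
    by (cases "l = n + k + 3") (auto simp: ballot_def)
qed

text \<open>The value of \<open>ballot n k l\<close> depends on \<open>k\<close> and
  \<open>l\<close> only through the difference of the two. Hence \<open>ballot n n (l - 1)\<close>
  equals \<open>ballot n (Suc n) l\<close>, and this is Pascal's rule again.\<close>

lemma ballot_Pascal_diagonal:
  assumes "l \<ge> 1"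
  shows "ballot (Suc n) (Suc n) l = ballot (Suc n) n l + ballot n n (l - 1)"
proof (cases "l \<le> 2 * n + 2")
  case True
  then have "Suc (Suc n) + Suc n - l = Suc (2 * n + 2 - l)"
    "Suc n + n - (l - 1) = 2 * n + 2 - l" "l - 1 \<le> Suc n + n" using assms by simp_all
  with True show ?thesis
    by (simp add: ballot_def mult_2 del: One_nat_def)
next
  case False
  then show ?thesis
    by (cases "l = 2 * n + 3") (auto simp: ballot_def)
qed

text \<open>Outer induction on the length, inner induction on the cap; the two cases of the inner
  step match the two Pascal identities.\<close>

lemma card_subdiagonal_lists:
  assumes "l \<ge> 1" "k \<le> n"
  shows "int (card (subdiagonal_lists (Suc n) k l)) = ballot n k l"
  using assms
proof (induction n arbitrary: k l)
  case 0
  then show ?case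
    by (auto simp: card_subdiagonal_lists_0 ballot_def)
next
  case (Suc n)
  note outer_IH = Suc.IH
  from Suc.prems show ?case
  proof (induction k)
    case 0
    then show ?case
      by (cases "l = 1") (auto simp: card_subdiagonal_lists_0 ballot_def binomial_eq_0)
  next
    case (Suc k)
    note inner = Suc
    have l: "1 \<le> l" using inner by blast
    have k: "k \<le> n" using inner by simp
    have prev: "int (card (subdiagonal_lists (Suc (Suc n)) k l)) = ballot (Suc n) k l"
      using inner by simp
    \<comment> \<open>Raising the cap to \<open>Suc k\<close> adds the lists ending in
      \<open>Suc k\<close>. For \<open>k = n\<close> this last entry is a contact, and the remaining
      list of length \<open>Suc n\<close> may be capped by \<open>n\<close> instead of
      \<open>Suc n\<close>.\<close>
    have step: "card (subdiagonal_lists (Suc (Suc n)) (Suc k) l)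
        = card (subdiagonal_lists (Suc (Suc n)) k l) +
          (if k = n then card (subdiagonal_lists (Suc n) n (l - 1))
           else card (subdiagonal_lists (Suc n) (Suc k) l))"
    proof -
      have "min (Suc k) (Suc n) = Suc k" "min k (Suc n) = k" using k by auto
      then show ?thesis
        unfolding card_subdiagonal_lists_Suc[of "Suc n"] using l
        by (simp add: subdiagonal_lists_bound_cap[of "Suc n" "Suc n"])
    qed
    show ?case
    proof (cases "k = n")
      case False
      then have "int (card (subdiagonal_lists (Suc n) (Suc k) l)) = ballot n (Suc k) l"
        using outer_IH[OF l, of "Suc k"] k by simp
      with False show ?thesis
        by (simp only: step prev ballot_Pascal of_nat_add if_False)
    next
      case True
      have "int (card (subdiagonal_lists (Suc n) n (l - 1))) = ballot n n (l - 1)"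
      proof (cases "l = 1")
        case True
        \<comment> \<open>The induction hypothesis does not cover \<open>l - 1 = 0\<close>. Here the
          count is 0, and \<open>ballot n n 0\<close> is the difference of the two equal middle
          binomials.\<close>
        have "Suc (n + n) choose n = Suc (n + n) choose Suc n"
          using binomial_symmetric[of n "Suc (n + n)"] by simp
        with True show ?thesis
          by (simp add: no_contacts_empty ballot_def)
      next
        case False
        with l have "1 \<le> l - 1" by simp
        then show ?thesis
          by (rule outer_IH) simp
      qed
      with True show ?thesis
        using prev step ballot_Pascal_diagonal[OF l] by simp
    qed
  qed
qed

lemma real_ballot_diagonal:
  assumes "l \<ge> 1"
  shows "real_of_int (ballot n n l) =
    (if l \<le> Suc n then real l / real (2 * Suc n - l) * real ((2 * Suc n - l) choose Suc n) else 0)"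
proof (cases "l \<le> Suc n")
  case True
  define m where "m = 2 * n + 1 - l"
  have m: "2 * Suc n - l = Suc m" "Suc n + n - l = m" "n \<le> m"
    using True by (auto simp: m_def)
  have 1: "real (Suc n) * real (Suc m choose Suc n) = real (Suc m) * real (m choose n)"
    by (metis Suc_times_binomial_eq mult.commute of_nat_mult)
  have 2: "real (Suc m choose Suc n) = real (m choose n) + real (m choose Suc n)"
    by simp
  have l: "real l = 2 * real (Suc n) - real (Suc m)"
    using True by (simp add: m_def)
  \<comment> \<open>With \<open>l\<close> written as \<open>2 * Suc n - Suc m\<close>, the first
    product is rewritten by absorption and the second by Pascal's rule.\<close>
  have "real l * real (Suc m choose Suc n)
      = real (Suc m) * (real (m choose n) - real (m choose Suc n))"
    unfolding l left_diff_distrib using 1 2 by (simp add: algebra_simps)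
  then have "real l / real (Suc m) * real (Suc m choose Suc n) = real (m choose n) - real (m choose Suc n)"
    by (simp add: field_simps)
  then show ?thesis
    using True m by (simp add: ballot_def)
next
  case False
  \<comment> \<open>Either the upper index is too small for both binomials, or the guard in
    \<open>ballot\<close> fails.\<close>
  then have "Suc n + n - l < n \<or> l > Suc n + n \<or> n = 0" by auto
  with False show ?thesis
    by (auto simp: ballot_def binomial_eq_0)
qed


section \<open>Regions in the dominant cone\<close>

text \<open>The rank counts from the top of the index type, so that \<open>x $ i\<close> increases with \<open>rank i\<close>
  on the dominant cone.\<close>

definition rank :: "'n::{finite,linorder} \<Rightarrow> nat" where
  "rank i = card {i<..}"

definition unrank :: "nat \<Rightarrow> 'n::{finite,linorder}" where
  "unrank = inv_into UNIV rank"

lemma rank_less_iff: "rank i < rank j \<longleftrightarrow> j < i"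
proof -
  have *: "rank i < rank j" if "j < i" for i j :: 'a
    unfolding rank_def using that by (intro psubset_card_mono) auto
  show ?thesis
    using *[of i j] *[of j i] by (cases i j rule: linorder_cases) auto
qed

lemma inj_rank: "inj rank"
  by (rule injI) (metis less_irrefl neq_iff rank_less_iff)

lemma rank_le_iff: "rank i \<le> rank j \<longleftrightarrow> j \<le> i"
  by (meson leD leI rank_less_iff)

lemma range_rank: "range (rank :: 'n \<Rightarrow> nat) = {..<CARD('n::{finite,linorder})}"
proof (rule card_subset_eq)
  have "rank i < CARD('n)" for i :: 'n
    unfolding rank_def by (rule psubset_card_mono) auto
  then show "range (rank :: 'n \<Rightarrow> nat) \<subseteq> {..<CARD('n)}"
    by auto
qed (simp_all add: card_image inj_rank)

lemma rank_less_card: "rank (i :: 'n) < CARD('n::{finite,linorder})"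
  using range_rank[where 'n = 'n] by blast

lemma rank_unrank:
  assumes "m < CARD('n)"
  shows "rank (unrank m :: 'n::{finite,linorder}) = m"
  unfolding unrank_def by (rule f_inv_into_f) (use assms range_rank[where 'n = 'n] in simp)

lemma unrank_rank: "unrank (rank i) = i"
  unfolding unrank_def by (simp add: inj_rank)

section \<open>Codes of dominant points\<close>

definition dominant_points :: "(real ^ 'n::{finite,linorder}) set" where
  "dominant_points = catalan_complement \<inter> dominant_cone"

definition far_below :: "real ^ 'n \<Rightarrow> 'n \<Rightarrow> 'n set" where
  "far_below x i = {j. x $ j + 1 < x $ i}"

definition code :: "real ^ 'n::{finite,linorder} \<Rightarrow> nat list" where
  "code x = map (\<lambda>m. card (far_below x (unrank m))) [0..<CARD('n)]"

lemma dominant_points_antimono: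
  assumes "x \<in> dominant_points"
  shows "x $ i < x $ j \<longleftrightarrow> j < i" and "x $ i \<le> x $ j \<longleftrightarrow> j \<le> i"
proof -
  have *: "x $ i < x $ j" if "j < i" for i j
    using assms that by (auto simp: dominant_points_def dominant_cone_def)
  show "x $ i < x $ j \<longleftrightarrow> j < i"
    using *[of i j] *[of j i] by (cases i j rule: linorder_cases) auto
  show "x $ i \<le> x $ j \<longleftrightarrow> j \<le> i"
    using *[of i j] *[of j i] by (cases i j rule: linorder_cases) auto
qed

lemma dominant_points_ne:
  assumes "x \<in> dominant_points"
  shows "x $ j + 1 \<noteq> x $ i"
proof (cases "i = j")
  case False
  then have "x $ i - x $ j \<noteq> 1"
    using assms by (auto simp: dominant_points_def catalan_complement_def)
  then show ?thesis by linarith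
qed simp

lemma far_below_subset:
  assumes "x \<in> dominant_points"
  shows "far_below x i \<subseteq> {i<..}"
  using dominant_points_antimono(1)[OF assms, of _ i] by (fastforce simp: far_below_def)

text \<open>\<open>far_below x i\<close> is a final segment of the index type, because coordinates
  decrease along it. A final segment is determined by its size, so the code loses no information
  about \<open>far_below\<close>.\<close>

lemma mem_far_below_iff:
  assumes x: "x \<in> dominant_points"
  shows "j \<in> far_below x i \<longleftrightarrow> rank j < card (far_below x i)"
proof
  assume j: "j \<in> far_below x i"
  have "{j..} \<subseteq> far_below x i"
  proof
    fix k assume "k \<in> {j..}"
    with j dominant_points_antimono(2)[OF x, of k j] show "k \<in> far_below x i"
      by (auto simp: far_below_def)
  qed
  then have "card {j..} \<le> card (far_below x i)"
    by (intro card_mono) auto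
  moreover have "rank j < card {j..}"
    unfolding rank_def by (intro psubset_card_mono) auto
  ultimately show "rank j < card (far_below x i)" by simp
next
  assume less: "rank j < card (far_below x i)"
  show "j \<in> far_below x i"
  proof (rule ccontr)
    assume j: "j \<notin> far_below x i"
    have "far_below x i \<subseteq> {j<..}"
    proof
      fix k assume "k \<in> far_below x i"
      with j dominant_points_antimono(1)[OF x, of k j] show "k \<in> {j<..}"
        by (auto simp: far_below_def)
    qed
    then have "card (far_below x i) \<le> rank j"
      unfolding rank_def by (intro card_mono) auto
    with less show False by simp
  qed
qed

lemma length_code [simp]:
  fixes x :: "real ^ 'n::{finite,linorder}"
  shows "length (code x) = CARD('n)"
  by (simp add: code_def)

lemma code_nth:
  fixes x :: "real ^ 'n::{finite,linorder}"
  shows "m < CARD('n) \<Longrightarrow> code x ! m = card (far_below x (unrank m))"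
  by (simp add: code_def)

lemma code_nth_rank: "code x ! rank i = card (far_below x i)"
  by (simp add: code_nth rank_less_card unrank_rank)

lemma code_eq_iff:
  assumes "x \<in> dominant_points" "y \<in> dominant_points"
  shows "code x = code y \<longleftrightarrow> far_below x = far_below y"
proof
  assume "code x = code y"
  then have "card (far_below x i) = card (far_below y i)" for i
    by (metis code_nth_rank)
  then show "far_below x = far_below y"
    using assms by (intro ext set_eqI) (simp add: mem_far_below_iff)
next
  assume "far_below x = far_below y"
  then show "code x = code y" by (simp add: code_def)
qed

text \<open>A larger coordinate has more coordinates far below it, and the one at position
  \<open>m\<close> has only \<open>m\<close> coordinates below it at all.\<close>

lemma subdiagonal_code:
  fixes x :: "real ^ 'n::{finite,linorder}"
  assumes x: "x \<in> dominant_points"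
  shows "subdiagonal (code x)"
  unfolding subdiagonal_def sorted_iff_nth_mono length_code
proof (intro conjI allI impI)
  fix m m' assume m: "m \<le> m'" "m' < CARD('n)"
  then have "(unrank m' :: 'n) \<le> unrank m"
    by (simp add: rank_le_iff[symmetric] rank_unrank)
  then have "far_below x (unrank m) \<subseteq> far_below x (unrank m')"
    using dominant_points_antimono(2)[OF x, of "unrank m" "unrank m'"]
    by (auto simp: far_below_def)
  with m show "code x ! m \<le> code x ! m'"
    by (simp add: code_nth card_mono)
next
  fix m assume m: "m < CARD('n)"
  have "card (far_below x (unrank m)) \<le> rank (unrank m :: 'n)"
    unfolding rank_def by (intro card_mono far_below_subset x) auto
  with m show "code x ! m \<le> m"
    by (simp add: code_nth rank_unrank)
qed

text \<open>Cut the coordinates wherever a consecutive gap exceeds 1. A block end is the largest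
  index, hence the lowest coordinate, of a block; the largest index of all always qualifies.\<close>

definition block_ends :: "real ^ 'n::{finite,linorder} \<Rightarrow> 'n set" where
  "block_ends x = {i. far_below x i = {i<..}}"

text \<open>\<open>far_below x i\<close> lies in \<open>{i<..}\<close>, which has
  \<open>rank i\<close> elements, so equal cardinality means equal sets.\<close>

lemma contacts_code:
  fixes x :: "real ^ 'n::{finite,linorder}"
  assumes x: "x \<in> dominant_points"
  shows "contacts (code x) = card (block_ends x)"
proof -
  have eq: "far_below x i = {i<..} \<longleftrightarrow> code x ! rank i = rank i" for i
    unfolding code_nth_rank unfolding rank_def
    by (metis card_subset_eq far_below_subset[OF x] finite)
  have "{m. m < CARD('n) \<and> code x ! m = m} = rank ` block_ends x"
  proof (intro set_eqI iffI)
    fix m assume "m \<in> {m. m < CARD('n) \<and> code x ! m = m}"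
    then have "m = rank (unrank m :: 'n)" "unrank m \<in> block_ends x"
      by (auto simp: block_ends_def eq rank_unrank)
    then show "m \<in> rank ` block_ends x" by blast
  qed (auto simp: block_ends_def eq rank_less_card)
  then show ?thesis
    by (simp add: contacts_def card_image inj_on_subset[OF inj_rank])
qed

subsection \<open>Every subdiagonal sequence is a code\<close>

text \<open>Build the points from the lowest up. The new highest point \<open>u\<close> has finitely
  many strict lower and upper bounds, and these are compatible because the sequence is weakly
  increasing.\<close>

lemma ex_realization:
  assumes "subdiagonal gs"
  shows "\<exists>y :: nat \<Rightarrow> real. (\<forall>i<length gs. \<forall>j<i. y j < y i) \<and>
     (\<forall>i<length gs. \<forall>j<length gs. (j < gs ! i \<longrightarrow> y j + 1 < y i) \<and> (gs ! i \<le> j \<longrightarrow> y i < y j + 1))"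
  using assms
proof (induction gs rule: rev_induct)
  case (snoc g gs)
  define n where "n = length gs"
  have gs: "subdiagonal gs" "\<And>h. h \<in> set gs \<Longrightarrow> h \<le> g" "g \<le> n"
    using snoc.prems by (auto simp: subdiagonal_snoc n_def)
  obtain y :: "nat \<Rightarrow> real" where
    inc: "\<And>i j. i < n \<Longrightarrow> j < i \<Longrightarrow> y j < y i" and
    far: "\<And>i j. i < n \<Longrightarrow> j < n \<Longrightarrow> j < gs ! i \<Longrightarrow> y j + 1 < y i" and
    near: "\<And>i j. i < n \<Longrightarrow> j < n \<Longrightarrow> gs ! i \<le> j \<Longrightarrow> y i < y j + 1"
    using snoc.IH[OF gs(1)] unfolding n_def by blast
  have le: "gs ! i \<le> i" if "i < n" for i
    using that gs(1) by (auto simp: subdiagonal_def n_def)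
  have "\<exists>u. (\<forall>j<n. y j < u) \<and> (\<forall>j<g. y j + 1 < u) \<and> (\<forall>j<n. g \<le> j \<longrightarrow> u < y j + 1)"
  proof -
    \<comment> \<open>\<open>A\<close> collects the lower bounds required of \<open>u\<close>, and
      \<open>B\<close> the upper bounds.\<close>
    define A where "A = y ` {..<n} \<union> (\<lambda>j. y j + 1) ` {..<g}"
    define B where "B = (\<lambda>j. y j + 1) ` {g..<n}"
    have AB: "a < b" if a: "a \<in> A" and b: "b \<in> B" for a b
    proof -
      obtain k where k: "g \<le> k" "k < n" "b = y k + 1"
        using b by (auto simp: B_def)
      from a consider i where "i < n" "a = y i" | j where "j < g" "a = y j + 1"
        by (auto simp: A_def)
      then show ?thesis
      proof cases
        case 1
        \<comment> \<open>Monotonicity enters here: \<open>gs ! i \<le> g \<le> k\<close>, so the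
          earlier point \<open>y i\<close> is already less than 1 above \<open>y k\<close>.\<close>
        then have "gs ! i \<le> k"
          using gs(2)[of "gs ! i"] k by (simp add: n_def)
        then show ?thesis using near[of i k] 1 k by simp
      next
        case 2
        then show ?thesis using inc[of k j] k by simp
      qed
    qed
    have "finite A" "finite B" by (auto simp: A_def B_def)
    have "\<exists>u. (\<forall>a\<in>A. a < u) \<and> (\<forall>b\<in>B. u < b)"
    proof (cases "B = {}")
      case True
      \<comment> \<open>Inserting 0 keeps the maximum meaningful when \<open>A\<close> is empty, as
        it is for the first point.\<close>
      have "a < Max (insert 0 A) + 1" if "a \<in> A" for a
      proof -
        have "a \<le> Max (insert 0 A)"
          using that \<open>finite A\<close> by (intro Max_ge) auto
        then show ?thesis by linarith
      qed
      with True show ?thesis by blast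
    next
      case False
      note B = this
      show ?thesis
      proof (cases "A = {}")
        case True
        obtain u where "u < Min B" using lt_ex by blast
        with True B \<open>finite B\<close> show ?thesis by auto
      next
        case False
        then have "Max A < Min B"
          using B \<open>finite A\<close> \<open>finite B\<close> AB by simp
        then obtain u where "Max A < u" "u < Min B"
          using dense by blast
        with B False \<open>finite A\<close> \<open>finite B\<close> show ?thesis by auto
      qed
    qed
    then obtain u where "\<forall>a\<in>A. a < u" "\<forall>b\<in>B. u < b" by blast
    then show ?thesis
      by (intro exI[of _ u]) (simp add: A_def B_def ball_Un)
  qed
  then obtain u where u: "\<And>j. j < n \<Longrightarrow> y j < u" "\<And>j. j < g \<Longrightarrow> y j + 1 < u"
    "\<And>j. j < n \<Longrightarrow> g \<le> j \<Longrightarrow> u < y j + 1" by blast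
  have len: "length (gs @ [g]) = Suc n" by (simp add: n_def)
  have nth: "(gs @ [g]) ! i = (if i < n then gs ! i else g)" if "i < Suc n" for i
    using that by (auto simp: nth_append n_def)
  show ?case
    unfolding len
  proof (intro exI[of _ "y(n := u)"] conjI allI impI)
    fix i j assume "i < Suc n" "j < i"
    then show "(y(n := u)) j < (y(n := u)) i"
      using inc[of i j] u(1)[of j] by (cases "i = n") auto
  next
    fix i j assume ij: "i < Suc n" "j < Suc n" "j < (gs @ [g]) ! i"
    show "(y(n := u)) j + 1 < (y(n := u)) i"
      using ij far[of i j] u(2)[of j] le[of i] gs(3) by (auto simp: nth less_Suc_eq split: if_splits)
  next
    fix i j assume ij: "i < Suc n" "j < Suc n" "(gs @ [g]) ! i \<le> j"
    show "(y(n := u)) i < (y(n := u)) j + 1"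
      using ij near[of i j] u(1)[of i] u(3)[of j] by (auto simp: nth less_Suc_eq split: if_splits)
  qed
qed simp

lemma ex_code_eq:
  assumes gs: "subdiagonal gs" and len: "length gs = CARD('n::{finite,linorder})"
  shows "\<exists>x :: real ^ 'n::{finite,linorder}. x \<in> dominant_points \<and> code x = gs"
proof -
  let ?n = "CARD('n)"
  obtain y :: "nat \<Rightarrow> real" where
    inc: "\<And>i j. i < ?n \<Longrightarrow> j < i \<Longrightarrow> y j < y i" and
    far: "\<And>i j. i < ?n \<Longrightarrow> j < ?n \<Longrightarrow> j < gs ! i \<Longrightarrow> y j + 1 < y i" and
    near: "\<And>i j. i < ?n \<Longrightarrow> j < ?n \<Longrightarrow> gs ! i \<le> j \<Longrightarrow> y i < y j + 1"
    using ex_realization[OF gs] unfolding len by blast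
  define x :: "(real, 'n) vec" where "x = (\<chi> i. y (rank i))"
  have ne: "y (rank i) \<noteq> y (rank j) + 1" for i j :: 'n
    using far[of "rank i" "rank j"] near[of "rank i" "rank j"] rank_less_card[of i] rank_less_card[of j]
    by (cases "rank j < gs ! rank i") auto
  have cone: "x \<in> dominant_cone"
    by (auto simp: dominant_cone_def x_def rank_less_card rank_less_iff intro!: inc)
  have "x $ i - x $ j \<notin> {-1, 0, 1}" if "i \<noteq> j" for i j
  proof -
    have "x $ i \<noteq> x $ j"
      using that cone unfolding dominant_cone_def by (cases i j rule: linorder_cases) fastforce+
    then show ?thesis
      using ne[of i j] ne[of j i] by (auto simp: x_def)
  qed
  with cone have x: "x \<in> dominant_points"
    by (auto simp: dominant_points_def catalan_complement_def)
  have "card (far_below x i) = gs ! rank i" for i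
  proof -
    have "j \<in> far_below x i \<longleftrightarrow> rank j < gs ! rank i" for j
      using far[of "rank i" "rank j"] near[of "rank i" "rank j"] rank_less_card[of i] rank_less_card[of j]
      by (cases "rank j < gs ! rank i") (auto simp: far_below_def x_def)
    then have "rank ` far_below x i = {..<gs ! rank i} \<inter> range (rank :: 'n \<Rightarrow> nat)"
      by auto
    \<comment> \<open>The bound \<open>gs ! rank i \<le> rank i\<close> keeps this initial segment
      inside the range of \<open>rank\<close>.\<close>
    also have "\<dots> = {..<gs ! rank i}"
      using gs rank_less_card[of i] len by (fastforce simp: range_rank subdiagonal_def)
    finally show ?thesis
      by (metis card_image card_lessThan inj_on_subset inj_rank subset_UNIV)
  qed
  then have "code x = gs"
    by (intro nth_equalityI) (simp_all add: len code_nth rank_unrank)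
  with x show ?thesis by blast
qed


subsection \<open>Regions are the fibres of the code\<close>

text \<open>Intermediate value theorem: a connected set that misses a hyperplane stays on one side
  of it.\<close>

lemma connected_nonzero_same_sign:
  fixes h :: "'a::topological_space \<Rightarrow> real"
  assumes S: "connected S" and cont: "continuous_on S h" and nz: "\<And>z. z \<in> S \<Longrightarrow> h z \<noteq> 0"
    and xy: "x \<in> S" "y \<in> S" and pos: "h x > 0"
  shows "h y > 0"
proof (rule ccontr)
  assume "\<not> h y > 0"
  moreover have "connected (h ` S)"
    using S cont by (rule connected_continuous_image[rotated])
  ultimately have "{h y..h x} \<subseteq> h ` S"
    using xy by (intro connected_contains_Icc) auto
  moreover have "0 \<in> {h y..h x}"
    using \<open>\<not> h y > 0\<close> pos by simp
  ultimately show False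
    using nz by auto
qed

lemma convex_coordinate_diff_gt: "convex {z :: real ^ 'n. c < z $ i - z $ j}"
proof -
  have "{z :: real ^ 'n. c < z $ i - z $ j} = {z. (axis i 1 - axis j 1) \<bullet> z > c}"
    by (simp add: inner_diff_left inner_axis')
  then show ?thesis
    by (simp only: convex_halfspace_gt)
qed

text \<open>No hyperplane is crossed inside a component, so all order relations and comparisons with
  1 persist. Conversely, the fibre is an intersection of open half-spaces, hence convex and
  connected.\<close>

lemma component_eq:
  assumes x: "x \<in> dominant_points"
  shows "connected_component_set catalan_complement x = {z \<in> dominant_points. far_below z = far_below x}"
    (is "?S = ?T")
proof
  have xc: "x \<in> catalan_complement"
    using x by (simp add: dominant_points_def)
  have S: "connected ?S" "?S \<subseteq> catalan_complement" "x \<in> ?S"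
    using xc by (auto simp: connected_component_subset)
  show "?S \<subseteq> ?T"
  proof
    fix y assume y: "y \<in> ?S"
    have sign: "0 < x $ i - x $ j - c \<longleftrightarrow> 0 < y $ i - y $ j - c" if "i \<noteq> j" "c \<in> {0, 1}" for i j c
    proof -
      have nz: "z $ i - z $ j - c \<noteq> 0" if "z \<in> ?S" for z
        using S(2) that \<open>i \<noteq> j\<close> \<open>c \<in> {0, 1}\<close> unfolding catalan_complement_def by fastforce
      have cont: "continuous_on ?S (\<lambda>z. z $ i - z $ j - c)"
        by (intro continuous_intros)
      show ?thesis
        using connected_nonzero_same_sign[OF S(1) cont nz S(3) y]
          connected_nonzero_same_sign[OF S(1) cont nz y S(3)] by blast
    qed
    have "y \<in> dominant_cone"
      using sign[of _ _ 0] x by (fastforce simp: dominant_points_def dominant_cone_def)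
    moreover have "y \<in> catalan_complement"
      using S(2) y by blast
    moreover have "j \<in> far_below y i \<longleftrightarrow> j \<in> far_below x i" for i j
      using sign[of i j 1] by (cases "i = j") (auto simp: far_below_def algebra_simps)
    ultimately show "y \<in> ?T"
      by (auto simp: dominant_points_def)
  qed
  \<comment> \<open>Differences equal to 1 are excluded on \<open>?T\<close>, so the negated
    condition is strict too. It is written as a lower bound on \<open>z $ j - z $ i\<close> so that
    one convexity lemma serves all half-spaces.\<close>
  have "?T = (\<Inter>i. \<Inter>j\<in>{i<..}. {z. 0 < z $ i - z $ j}) \<inter>
     (\<Inter>i. \<Inter>j. if j \<in> far_below x i then {z. 1 < z $ i - z $ j} else {z. -1 < z $ j - z $ i})"
    (is "_ = ?C \<inter> ?D")
  proof
    show "?T \<subseteq> ?C \<inter> ?D"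
    proof
      fix z assume "z \<in> ?T"
      then have z: "z \<in> dominant_points" "far_below z = far_below x" by auto
      have "z \<in> ?C"
        using z(1) by (auto simp: dominant_points_def dominant_cone_def)
      moreover have "z \<in> (if j \<in> far_below x i then {z. 1 < z $ i - z $ j} else {z. -1 < z $ j - z $ i})" for i j
        using dominant_points_ne[OF z(1), of j i] unfolding z(2)[symmetric] by (auto simp: far_below_def)
      ultimately show "z \<in> ?C \<inter> ?D" by blast
    qed
    show "?C \<inter> ?D \<subseteq> ?T"
    proof
      fix z assume z: "z \<in> ?C \<inter> ?D"
      have cone: "z $ j < z $ i" if "i < j" for i j
        using z that by auto
      have D: "if j \<in> far_below x i then z $ j + 1 < z $ i else z $ i < z $ j + 1" for i j
      proof -
        have "z \<in> (if j \<in> far_below x i then {z. 1 < z $ i - z $ j} else {z. -1 < z $ j - z $ i})"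
          using z by blast
        then show ?thesis by (auto split: if_splits)
      qed
      have "z $ i - z $ j \<notin> {-1, 0, 1}" if "i \<noteq> j" for i j
      proof -
        have "z $ i \<noteq> z $ j"
          using that cone[of i j] cone[of j i] by (cases i j rule: linorder_cases) auto
        moreover have "z $ i \<noteq> z $ j + 1" "z $ j \<noteq> z $ i + 1"
          using D[of j i] D[of i j] by (auto split: if_splits)
        ultimately show ?thesis by auto
      qed
      moreover have "j \<in> far_below z i \<longleftrightarrow> j \<in> far_below x i" for i j
        using D[of j i] by (auto simp: far_below_def split: if_splits)
      ultimately show "z \<in> ?T"
        using cone by (auto simp: dominant_points_def dominant_cone_def catalan_complement_def)
    qed
  qed
  moreover have "convex (?C \<inter> ?D)"
    by (intro convex_Int convex_INT convex_coordinate_diff_gt)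
      (simp only: convex_coordinate_diff_gt simp_thms split: if_split)
  ultimately have "connected ?T"
    by (simp only: convex_connected)
  then show "?T \<subseteq> ?S"
    using x by (intro connected_component_maximal) (auto simp: dominant_points_def)
qed

subsection \<open>The level of a region\<close>

text \<open>Scaling a nearest point of \<open>W\<close> to \<open>x + t *\<^sub>R v\<close> by
  \<open>1 / t\<close> gives points of \<open>W\<close> that tend to \<open>v\<close>, and
  \<open>W\<close> is closed.\<close>

lemma ray_direction_in_subspace:
  fixes x v :: "'a::euclidean_space"
  assumes W: "subspace W" and r: "\<And>t. t > 0 \<Longrightarrow> infdist (x + t *\<^sub>R v) W \<le> r"
  shows "v \<in> W"
proof -
  have "\<exists>w\<in>W. dist w v < e" if "e > 0" for e
  proof -
    have "0 \<le> r" using order_trans[OF infdist_nonneg r[of 1]] by simp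
    \<comment> \<open>Large enough that the total error \<open>r + norm x\<close> falls below
      \<open>e\<close> after division by \<open>t\<close>.\<close>
    define t where "t = (r + norm x) / e + 1"
    have t: "t > 0"
      using \<open>0 \<le> r\<close> that by (simp add: t_def add_nonneg_pos)
    have te: "r + norm x < t * e"
      using that by (simp add: t_def field_simps)
    have "W \<noteq> {}" using subspace_0[OF W] by auto
    then obtain w where w: "w \<in> W" "infdist (x + t *\<^sub>R v) W = dist (x + t *\<^sub>R v) w"
      by (rule infdist_attains_inf[OF closed_subspace[OF W]])
    have "w - t *\<^sub>R v = x - (x + t *\<^sub>R v - w)"
      by simp
    then have "norm (w - t *\<^sub>R v) \<le> norm x + norm (x + t *\<^sub>R v - w)"
      by (metis norm_triangle_ineq4)
    also have "\<dots> \<le> norm x + r"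
      using r[OF t] w(2) by (simp add: dist_norm)
    also have "\<dots> < t * e" using te by simp
    finally have "norm (w - t *\<^sub>R v) < t * e" .
    moreover have "w - t *\<^sub>R v = t *\<^sub>R ((1 / t) *\<^sub>R w - v)"
      using t by (simp add: scaleR_diff_right)
    ultimately have "norm ((1 / t) *\<^sub>R w - v) < e"
      using t by simp
    moreover have "(1 / t) *\<^sub>R w \<in> W"
      using W w(1) by (rule subspace_scale)
    ultimately show ?thesis
      by (auto simp: dist_norm)
  qed
  then have "v \<in> closure W"
    by (simp add: closure_approachable)
  then show ?thesis
    using closed_subspace[OF W] by simp
qed

definition indicator_vec :: "'n set \<Rightarrow> real ^ 'n" where
  "indicator_vec S = (\<chi> j. if j \<in> S then 1 else 0)"

text \<open>Raising \<open>S\<close> only widens gaps that already exceed 1, so no comparison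
  changes.\<close>

lemma translate_in_fibre:
  assumes x: "x \<in> dominant_points" and t: "t > 0"
    and S: "\<And>a b. a \<in> S \<Longrightarrow> b \<notin> S \<Longrightarrow> x $ b + 1 < x $ a"
  shows "x + t *\<^sub>R indicator_vec S \<in> dominant_points"
    and "far_below (x + t *\<^sub>R indicator_vec S) = far_below x"
proof -
  let ?z = "x + t *\<^sub>R indicator_vec S"
  have nth: "?z $ i = x $ i + (if i \<in> S then t else 0)" for i
    by (simp add: indicator_vec_def)
  have cone: "?z $ j < ?z $ i" if "i < j" for i j
    using S[of j i] dominant_points_antimono(1)[OF x, of j i] that t unfolding nth by auto
  have "?z $ i - ?z $ j \<notin> {-1, 0, 1}" if "i \<noteq> j" for i j
  proof -
    have "x $ i - x $ j \<notin> {-1, 0, 1}"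
      using x that by (auto simp: dominant_points_def catalan_complement_def)
    then show ?thesis
      using S[of i j] S[of j i] t unfolding nth by auto
  qed
  with cone show "?z \<in> dominant_points"
    by (auto simp: dominant_points_def dominant_cone_def catalan_complement_def)
  have "j \<in> far_below ?z i \<longleftrightarrow> j \<in> far_below x i" for i j
    using S[of i j] S[of j i] t unfolding far_below_def mem_Collect_eq nth by auto
  then show "far_below ?z = far_below x" by blast
qed

text \<open>The gap after a block end can grow without bound inside the region, while all distances
  within a block stay bounded; so a region stays near exactly the span of the block indicators.\<close>

lemma level_fibre:
  fixes x :: "real ^ 'n::{finite,linorder}"
  assumes x: "x \<in> dominant_points"
  shows "level {z \<in> dominant_points. far_below z = far_below x} = card (block_ends x)"
proof -
  let ?R = "{z \<in> dominant_points. far_below z = far_below x}"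
  define F where "F = block_ends x"
  \<comment> \<open>The end of the block containing \<open>j\<close>; it is topmost in the index
    order, so its coordinate is the lowest of the block.\<close>
  define top where "top j = Min {i \<in> F. j \<le> i}" for j
  define blk where "blk i = indicator_vec {j. top j = i}" for i
  have "far_below x (Max UNIV) = {Max UNIV<..}"
    using far_below_subset[OF x, of "Max UNIV"] by (auto simp: not_less[symmetric])
  then have "Max UNIV \<in> F"
    by (simp add: F_def block_ends_def)
  then have "{i \<in> F. j \<le> i} \<noteq> {}" for j
    using Max_ge[OF finite UNIV_I] by blast
  then have top_in: "top j \<in> {i \<in> F. j \<le> i}" for j
    unfolding top_def by (intro Min_in) auto
  then have topF: "top j \<in> F" and le_top: "j \<le> top j" for j
    by auto
  have top_le: "top j \<le> i" if "i \<in> F" "j \<le> i" for i j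
    unfolding top_def using that by (intro Min_le) auto
  have top_F: "top i = i" if "i \<in> F" for i
    using top_le[OF that, of i] le_top[of i] by simp
  have beyond: "x $ b + 1 < x $ a" if "top a < b" for a b
  proof -
    have "b \<in> far_below x (top a)"
      using topF[of a] that by (auto simp: F_def block_ends_def)
    moreover have "x $ top a \<le> x $ a"
      using dominant_points_antimono(2)[OF x] le_top by blast
    ultimately show ?thesis by (simp add: far_below_def)
  qed
  have cut: "x $ b + 1 < x $ a" if "top a < top b" for a b
  proof (rule beyond, rule ccontr)
    assume "\<not> top a < b"
    then have "top b \<le> top a" using top_le[OF topF] by simp
    with that show False by simp
  qed
  have blk_nth: "blk i $ j = (if top j = i then 1 else 0)" for i j
    by (simp add: blk_def indicator_vec_def)
  have inj: "inj_on blk F"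
  proof (rule inj_onI)
    fix i i' assume i: "i \<in> F" "i' \<in> F" "blk i = blk i'"
    then have "blk i' $ i = 1"
      using blk_nth[of i i] top_F[OF i(1)] by simp
    then show "i = i'"
      using blk_nth[of i' i] top_F[OF i(1)] by (simp split: if_splits)
  qed
  have indep: "independent (blk ` F)"
  proof (rule pairwise_orthogonal_independent)
    show "pairwise orthogonal (blk ` F)"
      unfolding pairwise_image
      by (auto simp: pairwise_def orthogonal_def inner_vec_def blk_nth intro!: sum.neutral)
    show "0 \<notin> blk ` F"
    proof
      assume "0 \<in> blk ` F"
      then obtain i where "i \<in> F" "0 = blk i" by blast
      then show False using blk_nth[of i i] top_F[of i] by (metis zero_index zero_neq_one)
    qed
  qed
  \<comment> \<open>Unless \<open>j\<close> ends its block, some larger index \<open>k\<close> has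
    its coordinate within 1 of \<open>z $ j\<close>. Each such move costs at most 1 and lowers the
    rank, so \<open>rank j\<close> bounds the total.\<close>
  have dist_le: "z $ j \<le> z $ top j + real (rank j)" if z: "z \<in> ?R" for z j
  proof (induction "rank j" arbitrary: j rule: less_induct)
    case less
    have zU: "z \<in> dominant_points" and zx: "far_below z = far_below x" using z by auto
    show ?case
    proof (cases "j \<in> F")
      case True
      then show ?thesis by (simp add: top_F)
    next
      case False
      then obtain k where k: "j < k" "k \<notin> far_below z j"
        using far_below_subset[OF x, of j] by (auto simp: F_def block_ends_def zx)
      then have jk: "z $ j \<le> z $ k + 1" by (simp add: far_below_def)
      have rank: "rank k < rank j" using k by (simp add: rank_less_iff)
      show ?thesis
      proof (cases "k \<le> top j")
        case True
        have "top k = top j"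
          using top_le[OF topF True] top_le[OF topF[of k], of j] le_top[of k] k by simp
        with less[OF rank] jk rank show ?thesis by simp
      next
        case False
        then have "z $ k \<le> z $ top j"
          using dominant_points_antimono(2)[OF zU, of k "top j"] by simp
        with jk rank show ?thesis by simp
      qed
    qed
  qed
  have upper: "?R \<subseteq> {z. infdist z (span (blk ` F)) \<le> real CARD('n) * real CARD('n)}"
  proof clarify
    fix z assume z: "z \<in> dominant_points" "far_below z = far_below x"
    \<comment> \<open>Replace every coordinate by that of its block end. Each coordinate moves by at
      most \<open>CARD('n)\<close>, and the l1 norm bounds the Euclidean distance.\<close>
    define w where "w = (\<Sum>i\<in>F. z $ i *\<^sub>R blk i)"
    have w: "w \<in> span (blk ` F)"
      unfolding w_def by (intro span_sum span_scale span_base) auto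
    have w_nth: "w $ j = z $ top j" for j
      using topF[of j] by (simp add: w_def blk_nth if_distrib[of "(*) _"] cong: if_cong)
    have "\<bar>(z - w) $ j\<bar> \<le> real CARD('n)" for j
    proof -
      have "z $ top j \<le> z $ j"
        using dominant_points_antimono(2)[OF z(1)] le_top by blast
      then show ?thesis
        using dist_le[of z j] z rank_less_card[of j] by (simp add: w_nth)
    qed
    then have "(\<Sum>j\<in>UNIV. \<bar>(z - w) $ j\<bar>) \<le> real CARD('n) * real CARD('n)"
      using sum_bounded_above[of UNIV "\<lambda>j. \<bar>(z - w) $ j\<bar>" "real CARD('n)"] by simp
    then have "dist z w \<le> real CARD('n) * real CARD('n)"
      using norm_le_l1_cart[of "z - w"] by (simp add: dist_norm)
    then show "infdist z (span (blk ` F)) \<le> real CARD('n) * real CARD('n)"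
      using infdist_le2[OF w] by blast
  qed
  show ?thesis
    unfolding level_def F_def[symmetric]
  proof (rule Least_equality)
    have "dim (span (blk ` F)) = card F"
      by (simp add: dim_eq_card_independent[OF indep] card_image[OF inj])
    with upper show "\<exists>W r. subspace W \<and> dim W = card F \<and> 0 < r \<and> ?R \<subseteq> {x. infdist x W \<le> r}"
      by (intro exI[of _ "span (blk ` F)"] exI[of _ "real CARD('n) * real CARD('n)"]) simp
  next
    fix m assume "\<exists>W r. subspace W \<and> dim W = m \<and> 0 < r \<and> ?R \<subseteq> {x. infdist x W \<le> r}"
    then obtain W r where W: "subspace W" "dim W = m" "?R \<subseteq> {x. infdist x W \<le> r}"
      by blast
    \<comment> \<open>Such an \<open>S\<close> is a union of upper blocks, so its indicator spans a
      ray that stays in the region.\<close>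
    have dir: "indicator_vec S \<in> W" if "\<And>a b. a \<in> S \<Longrightarrow> b \<notin> S \<Longrightarrow> top a < top b" for S
    proof (rule ray_direction_in_subspace[OF W(1)])
      fix t :: real assume "t > 0"
      then have "x + t *\<^sub>R indicator_vec S \<in> ?R"
        using translate_in_fibre[OF x, of t S] cut that by blast
      then show "infdist (x + t *\<^sub>R indicator_vec S) W \<le> r"
        using W(3) by blast
    qed
    have "blk i \<in> W" for i
    proof -
      \<comment> \<open>A single block is the difference of two consecutive unions of upper
        blocks.\<close>
      have "blk i = indicator_vec {j. top j \<le> i} - indicator_vec {j. top j < i}"
        by (auto simp: vec_eq_iff blk_nth indicator_vec_def)
      moreover have "indicator_vec {j. top j \<le> i} \<in> W" "indicator_vec {j. top j < i} \<in> W"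
        by (auto intro!: dir)
      ultimately show ?thesis
        using subspace_diff[OF W(1)] by metis
    qed
    then have "card (blk ` F) \<le> dim W"
      by (intro independent_card_le_dim indep) auto
    then show "card F \<le> m"
      using W(2) by (simp add: card_image[OF inj])
  qed
qed

subsection \<open>The count\<close>

text \<open>Maps with the same fibres on \<open>V\<close> have images in bijection; this turns
  counting components into counting codes.\<close>

lemma card_image_cong_kernel:
  assumes "\<And>x y. x \<in> V \<Longrightarrow> y \<in> V \<Longrightarrow> f x = f y \<longleftrightarrow> g x = g y"
  shows "card (f ` V) = card (g ` V)"
proof -
  have inv: "inv_into V f (f x) \<in> V" "f (inv_into V f (f x)) = f x" if "x \<in> V" for x
    using that by (auto intro: inv_into_into f_inv_into_f)
  have g: "g (inv_into V f (f x)) = g x" if "x \<in> V" for x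
    using assms[of "inv_into V f (f x)" x] inv[OF that] that by blast
  have "bij_betw (\<lambda>c. g (inv_into V f c)) (f ` V) (g ` V)"
    unfolding bij_betw_def inj_on_def by (auto simp: g assms image_iff)
  then show ?thesis
    by (rule bij_betw_same_card)
qed

text \<open>The coefficient form of the identity, with \<open>CARD('n)\<close> as the dimension. The
  zero branch reflects that the \<open>l\<close>-th power of \<open>tC(t)\<close> starts in degree
  \<open>l\<close>.\<close>

theorem theorem5p2:
  fixes l :: nat
  assumes "l \<ge> 1"
  shows "real (card {R \<in> (catalan_regions :: (real ^ ('n::{finite,linorder})) set set).
                       R \<subseteq> dominant_cone \<and> level R = l})
       = (if l \<le> CARD('n)
          then real l / real (2 * CARD('n) - l) * real ((2 * CARD('n) - l) choose CARD('n))
          else 0)"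
proof -
  let ?comp = "connected_component_set (catalan_complement :: (real, 'n) vec set)"
  \<comment> \<open>The dominant points whose region has level \<open>l\<close>; its images under
    \<open>?comp\<close> and \<open>code\<close> are compared.\<close>
  define V :: "(real, 'n) vec set" where "V = {x \<in> dominant_points. card (block_ends x) = l}"
  have "{R \<in> (catalan_regions :: (real, 'n) vec set set). R \<subseteq> dominant_cone \<and> level R = l} = ?comp ` V"
  proof (intro set_eqI iffI)
    fix R :: "(real, 'n) vec set"
    assume R: "R \<in> {R \<in> catalan_regions. R \<subseteq> dominant_cone \<and> level R = l}"
    then obtain x where x: "x \<in> catalan_complement" "R = ?comp x"
      by (auto simp: catalan_regions_def)
    then have "x \<in> R" by simp
    with R x have xU: "x \<in> dominant_points" by (auto simp: dominant_points_def)
    then have "card (block_ends x) = l"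
      using R x(2) component_eq[OF xU] level_fibre[OF xU] by simp
    with xU x(2) show "R \<in> ?comp ` V" by (auto simp: V_def)
  next
    fix R assume "R \<in> ?comp ` V"
    then obtain x where x: "x \<in> dominant_points" "card (block_ends x) = l" "R = ?comp x"
      by (auto simp: V_def)
    moreover have "R \<in> catalan_regions"
      using x by (auto simp: catalan_regions_def dominant_points_def)
    moreover have "R \<subseteq> dominant_cone" "level R = l"
      using x component_eq[OF x(1)] level_fibre[OF x(1)] by (auto simp: dominant_points_def)
    ultimately show "R \<in> {R \<in> catalan_regions. R \<subseteq> dominant_cone \<and> level R = l}" by blast
  qed
  moreover have "card (?comp ` V) = card (code ` V)"
  proof (rule card_image_cong_kernel)
    fix x y assume "x \<in> V" "y \<in> V"
    then have U: "x \<in> dominant_points" "y \<in> dominant_points" by (auto simp: V_def)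
    show "?comp x = ?comp y \<longleftrightarrow> code x = code y"
      unfolding component_eq[OF U(1)] component_eq[OF U(2)] code_eq_iff[OF U] using U by auto
  qed
  moreover have "code ` V = subdiagonal_lists CARD('n) (CARD('n) - 1) l"
  proof
    show "code ` V \<subseteq> subdiagonal_lists CARD('n) (CARD('n) - 1) l"
    proof
      fix gs assume "gs \<in> code ` V"
      \<comment> \<open>An auxiliary cap that exceeds every entry of \<open>gs\<close> and is large
        enough to be lowered to \<open>CARD('n) - 1\<close>.\<close>
      then have "gs \<in> subdiagonal_lists CARD('n) (CARD('n) + Max (insert 0 (set gs))) l"
        by (auto simp: V_def subdiagonal_lists_def subdiagonal_code contacts_code
            intro!: trans_le_add2 Max_ge)
      then show "gs \<in> subdiagonal_lists CARD('n) (CARD('n) - 1) l"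
        by (simp add: subdiagonal_lists_bound_cap[of "CARD('n)" "CARD('n) + _"])
    qed
    show "subdiagonal_lists CARD('n) (CARD('n) - 1) l \<subseteq> code ` V"
    proof
      fix gs assume "gs \<in> subdiagonal_lists CARD('n) (CARD('n) - 1) l"
      then have gs: "subdiagonal gs" "length gs = CARD('n)" "contacts gs = l"
        by (auto simp: subdiagonal_lists_def)
      then obtain x :: "(real, 'n) vec" where "x \<in> dominant_points" "code x = gs"
        using ex_code_eq by blast
      with gs(3) show "gs \<in> code ` V"
        using contacts_code[of x] by (auto simp: V_def)
    qed
  qed
  moreover obtain n where n: "CARD('n) = Suc n"
    using not0_implies_Suc[of "CARD('n)"] by auto
  moreover have "real (card (subdiagonal_lists (Suc n) n l)) = real_of_int (ballot n n l)"
    using card_subdiagonal_lists[OF assms order_refl, of n] by (metis of_int_of_nat_eq)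
  ultimately show ?thesis
    using real_ballot_diagonal[OF assms, of n] by (simp only: diff_Suc_1)
qed

end
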